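(* Let $(B,+,\circ)$ be a brace. Then $$\mathcal{D}_r(B)=\{z\in B\mid \forall a,b\in B\quad (a\cdot b)\cdot z=a\cdot(b\cdot z)\}.$$
   Context: A (left) brace $(B,+,\circ)$ is a set with an abelian group structure $(B,+)$ and a group structure $(B,\circ)$ such that $a\circ(b+c)=a\circ b-a+a\circ c$ for all $a,b,c\in B$; $\circ$ binds more tightly than $+$ and $-$. The (right) distributor of $B$ is $\mathcal{D}_r(B)=\{z\in B\mid \forall a,b\in B\ \ (a+b)\circ z=a\circ z-z+b\circ z\}$. The operation $\cdot$ on $B$ is defined by $a\cdot b:=-a+a\circ b-b$ for all $a,b\in B$. *)

theory Defs
  imports "HOL-Algebra.Ring"
begin

text \<open>
  A brace is carried by a \<open>ring\<close> record: \<open>\<oplus>\<close> is the brace addition and \<open>\<otimes>\<close>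
  is the circle operation. The fields \<open>\<zero>\<close> and \<open>\<one>\<close> are the identities of
  the two groups; their equality follows from the axioms.
\<close>

locale brace = abelian_group B + group B for B (structure) +
  assumes brace_distrib:
    "\<lbrakk>a \<in> carrier B; b \<in> carrier B; c \<in> carrier B\<rbrakk>
      \<Longrightarrow> a \<otimes> (b \<oplus> c) = (a \<otimes> b \<ominus> a) \<oplus> a \<otimes> c"

definition right_distributor :: "('a, 'm) ring_scheme \<Rightarrow> 'a set"
  where "right_distributor B =
    {z \<in> carrier B. \<forall>a\<in>carrier B. \<forall>b\<in>carrier B.
      (a \<oplus>\<^bsub>B\<^esub> b) \<otimes>\<^bsub>B\<^esub> z = (a \<otimes>\<^bsub>B\<^esub> z \<ominus>\<^bsub>B\<^esub> z) \<oplus>\<^bsub>B\<^esub> b \<otimes>\<^bsub>B\<^esub> z}"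

definition brace_dot :: "[('a, 'm) ring_scheme, 'a, 'a] \<Rightarrow> 'a" (infixl "\<cdot>\<index>" 70)
  where "a \<cdot>\<^bsub>B\<^esub> b = ((\<ominus>\<^bsub>B\<^esub> a) \<oplus>\<^bsub>B\<^esub> a \<otimes>\<^bsub>B\<^esub> b) \<ominus>\<^bsub>B\<^esub> b"

end

theory Submission
  imports Defs
begin

text \<open>
  Since \<open>a \<otimes> b = a \<oplus> b \<oplus> a \<cdot> b\<close>, membership of \<open>z\<close> in the right distributor means that
  \<open>a \<mapsto> a \<cdot> z\<close> is additive. Associativity of \<open>\<otimes>\<close> and left distributivity of \<open>\<cdot>\<close> give
  \<open>(a \<oplus> b \<oplus> a \<cdot> b) \<cdot> z = a \<cdot> z \<oplus> b \<cdot> z \<oplus> a \<cdot> (b \<cdot> z)\<close>, which settles one inclusion.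

  For the other, let \<open>D a b\<close> be the symmetric defect of additivity. If
  \<open>(a \<cdot> b) \<cdot> z = a \<cdot> (b \<cdot> z)\<close> for all \<open>a, b\<close>, then
  \<open>D a (g \<cdot> c) = g \<cdot> D a c\<close> and \<open>D (g \<cdot> a) (g \<cdot> c) = g \<cdot> D a c\<close>, so that
  \<open>g \<cdot> (g \<cdot> D a c) = g \<cdot> D a c\<close>. Together with \<open>D a b = \<ominus> D (a \<oplus> b) (a \<cdot> b)\<close> this yields that
  each of \<open>a\<close>, \<open>b\<close> and \<open>a \<otimes> b\<close> fixes \<open>D a b\<close> under \<open>\<cdot>\<close>. Expanding the action of \<open>a \<otimes> b\<close> gives
  \<open>D a b = 3 D a b\<close>, and since \<open>x \<mapsto> x \<oplus> a \<cdot> x\<close> is injective, \<open>2 D a b = 0\<close> forces \<open>D a b = 0\<close>.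
\<close>

text \<open>Sets up \<open>algebra\<close> for the additive group alone, since
  \<open>\<oplus>\<close> and \<open>\<otimes>\<close> need not form a ring. Terms in
  \<open>\<otimes>\<close> and \<open>\<cdot>\<close> act as atoms whose closure has to be
  supplied.\<close>

lemma (in abelian_group) abelian_group_simprules
  [algebra abelian_group "zero G" "add G" "a_inv G" "a_minus G"]:
  "\<lbrakk>x \<in> carrier G; y \<in> carrier G\<rbrakk> \<Longrightarrow> x \<oplus> y \<in> carrier G"
  "\<zero> \<in> carrier G"
  "x \<in> carrier G \<Longrightarrow> \<ominus> x \<in> carrier G"
  "\<lbrakk>x \<in> carrier G; y \<in> carrier G\<rbrakk> \<Longrightarrow> x \<ominus> y \<in> carrier G"
  "\<lbrakk>x \<in> carrier G; y \<in> carrier G; w \<in> carrier G\<rbrakk> \<Longrightarrow> (x \<oplus> y) \<oplus> w = x \<oplus> (y \<oplus> w)"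
  "x \<in> carrier G \<Longrightarrow> \<zero> \<oplus> x = x"
  "x \<in> carrier G \<Longrightarrow> x \<oplus> \<zero> = x"
  "x \<in> carrier G \<Longrightarrow> \<ominus> x \<oplus> x = \<zero>"
  "x \<in> carrier G \<Longrightarrow> x \<oplus> \<ominus> x = \<zero>"
  "\<lbrakk>x \<in> carrier G; y \<in> carrier G\<rbrakk> \<Longrightarrow> x \<oplus> y = y \<oplus> x"
  "\<lbrakk>x \<in> carrier G; y \<in> carrier G; w \<in> carrier G\<rbrakk> \<Longrightarrow> x \<oplus> (y \<oplus> w) = y \<oplus> (x \<oplus> w)"
  "x \<ominus> y = x \<oplus> \<ominus> y"
  "\<lbrakk>x \<in> carrier G; y \<in> carrier G\<rbrakk> \<Longrightarrow> \<ominus> x \<oplus> (x \<oplus> y) = y"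
  "\<lbrakk>x \<in> carrier G; y \<in> carrier G\<rbrakk> \<Longrightarrow> x \<oplus> (\<ominus> x \<oplus> y) = y"
  "\<lbrakk>x \<in> carrier G; y \<in> carrier G\<rbrakk> \<Longrightarrow> \<ominus> (x \<oplus> y) = \<ominus> x \<oplus> \<ominus> y"
  "x \<in> carrier G \<Longrightarrow> \<ominus> (\<ominus> x) = x"
  "\<ominus> \<zero> = \<zero>"
  by (simp_all add: a_assoc minus_eq r_neg l_neg r_neg1 r_neg2 minus_add)
    (simp_all add: a_ac)

context brace
begin

lemma dot_closed [simp, intro]:
  "\<lbrakk>a \<in> carrier B; b \<in> carrier B\<rbrakk> \<Longrightarrow> a \<cdot> b \<in> carrier B"
  by (simp add: brace_dot_def)

lemma circ_eq_dot:
  assumes "a \<in> carrier B" "b \<in> carrier B"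
  shows "a \<otimes> b = a \<oplus> b \<oplus> a \<cdot> b"
proof -
  have "a \<otimes> b \<in> carrier B" using assms by simp
  with assms show ?thesis unfolding brace_dot_def by algebra
qed

lemma dot_add:
  assumes "a \<in> carrier B" "b \<in> carrier B" "c \<in> carrier B"
  shows "a \<cdot> (b \<oplus> c) = a \<cdot> b \<oplus> a \<cdot> c"
proof -
  have "a \<otimes> b \<in> carrier B" "a \<otimes> c \<in> carrier B" using assms by simp_all
  with assms show ?thesis unfolding brace_dot_def brace_distrib[OF assms] by algebra
qed

lemma dot_zero [simp]:
  assumes "a \<in> carrier B"
  shows "a \<cdot> \<zero> = \<zero>"
  using dot_add[of a \<zero> \<zero>] assms by simp

lemma dot_minus:
  assumes "a \<in> carrier B" "b \<in> carrier B"
  shows "a \<cdot> (\<ominus> b) = \<ominus> (a \<cdot> b)"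
  using dot_add[of a "\<ominus> b" b] assms
  by (intro add.inv_equality[symmetric]) (simp_all add: l_neg)

lemma one_dot [simp]:
  assumes "a \<in> carrier B"
  shows "\<one> \<cdot> a = \<zero>"
proof -
  \<comment> \<open>The product \<open>\<one> \<otimes> \<zero>\<close> is \<open>\<zero>\<close>,
    yet expands to \<open>\<one>\<close> by \<open>dot_zero\<close>.\<close>
  have one: "\<one> = \<zero>"
    using circ_eq_dot[of \<one> \<zero>] by simp
  have zero: "\<zero> \<otimes> a = a"
    using l_one[OF assms] unfolding one .
  show ?thesis
    unfolding one brace_dot_def zero using assms by algebra
qed

text \<open>In terms of the maps L_a: \<open>x \<mapsto> x \<oplus> a \<cdot> x\<close>, this is
  L_(a \<otimes> b) = L_a L_b.\<close>

lemma circ_dot: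
  assumes "a \<in> carrier B" "b \<in> carrier B" "c \<in> carrier B"
  shows "(a \<otimes> b) \<cdot> c = a \<cdot> c \<oplus> b \<cdot> c \<oplus> a \<cdot> (b \<cdot> c)"
proof -
  have "(a \<oplus> b \<oplus> c \<oplus> a \<cdot> b) \<oplus> (a \<otimes> b) \<cdot> c = a \<otimes> b \<oplus> c \<oplus> (a \<otimes> b) \<cdot> c"
    using assms by (simp add: circ_eq_dot a_ac)
  also have "\<dots> = (a \<otimes> b) \<otimes> c"
    using assms by (simp add: circ_eq_dot[of "a \<otimes> b" c])
  also have "\<dots> = a \<otimes> (b \<otimes> c)"
    using assms by (rule m_assoc)
  also have "\<dots> = (a \<oplus> b \<oplus> c \<oplus> a \<cdot> b) \<oplus> (a \<cdot> c \<oplus> b \<cdot> c \<oplus> a \<cdot> (b \<cdot> c))"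
    using assms by (simp add: circ_eq_dot dot_add a_ac)
  finally show ?thesis
    using assms by simp
qed

text \<open>The map L_a is inverted by L_(inv a), which provides the witness.\<close>

lemma dot_shift_surj:
  assumes "a \<in> carrier B" "c \<in> carrier B"
  obtains x where "x \<in> carrier B" "c = x \<oplus> a \<cdot> x"
proof
  have "a \<cdot> c \<oplus> inv a \<cdot> c \<oplus> a \<cdot> (inv a \<cdot> c) = \<zero>"
    using circ_dot[of a "inv a" c] assms by simp
  then have "c \<oplus> (a \<cdot> c \<oplus> inv a \<cdot> c \<oplus> a \<cdot> (inv a \<cdot> c)) = c"
    using assms by simp
  then show "c = (c \<oplus> inv a \<cdot> c) \<oplus> a \<cdot> (c \<oplus> inv a \<cdot> c)"
    using assms by (simp add: dot_add a_ac)
qed (use assms in simp)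

text \<open>Moves \<open>g\<close> past L_a at the price of conjugating it:
  \<open>a \<otimes> h = g \<otimes> a\<close> is expanded with \<open>circ_dot\<close> on both
  sides.\<close>

lemma dot_conj:
  assumes "a \<in> carrier B" "g \<in> carrier B" "x \<in> carrier B"
  defines "h \<equiv> inv a \<otimes> (g \<otimes> a)"
  shows "h \<cdot> x \<oplus> a \<cdot> (h \<cdot> x) = g \<cdot> (x \<oplus> a \<cdot> x)"
proof -
  have h: "h \<in> carrier B" using assms by simp
  have "a \<otimes> h = g \<otimes> a"
    using assms by (simp add: h_def m_assoc[symmetric])
  then have "a \<cdot> x \<oplus> (h \<cdot> x \<oplus> a \<cdot> (h \<cdot> x)) = a \<cdot> x \<oplus> g \<cdot> (x \<oplus> a \<cdot> x)"
    using circ_dot[of a h x] circ_dot[of g a x] assms(1-3) h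
    by (simp add: dot_add a_ac)
  then show ?thesis
    using assms(1-3) h by simp
qed

lemma right_distributor_iff_dot_add:
  "z \<in> right_distributor B \<longleftrightarrow>
    z \<in> carrier B \<and> (\<forall>a\<in>carrier B. \<forall>b\<in>carrier B. (a \<oplus> b) \<cdot> z = a \<cdot> z \<oplus> b \<cdot> z)"
proof -
  have "(a \<oplus> b) \<otimes> z = (a \<otimes> z \<ominus> z) \<oplus> b \<otimes> z \<longleftrightarrow> (a \<oplus> b) \<cdot> z = a \<cdot> z \<oplus> b \<cdot> z"
    if "a \<in> carrier B" "b \<in> carrier B" "z \<in> carrier B" for a b
  proof -
    have d: "a \<cdot> z \<in> carrier B" "b \<cdot> z \<in> carrier B" using that by simp_all
    have "(a \<oplus> b) \<otimes> z = (a \<oplus> b \<oplus> z) \<oplus> (a \<oplus> b) \<cdot> z"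
      using that by (simp add: circ_eq_dot)
    moreover have "(a \<otimes> z \<ominus> z) \<oplus> b \<otimes> z = (a \<oplus> b \<oplus> z) \<oplus> (a \<cdot> z \<oplus> b \<cdot> z)"
      unfolding circ_eq_dot[OF that(1,3)] circ_eq_dot[OF that(2,3)]
      using that d by algebra
    ultimately show ?thesis using that by simp
  qed
  then show ?thesis by (auto simp: right_distributor_def)
qed

definition dot_defect :: "'a \<Rightarrow> 'a \<Rightarrow> 'a \<Rightarrow> 'a"
  where "dot_defect z a b = (a \<oplus> b) \<cdot> z \<ominus> (a \<cdot> z \<oplus> b \<cdot> z)"

lemma dot_defect_closed [simp, intro]:
  "\<lbrakk>z \<in> carrier B; a \<in> carrier B; b \<in> carrier B\<rbrakk> \<Longrightarrow> dot_defect z a b \<in> carrier B"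
  by (simp add: dot_defect_def)

lemma dot_defect_comm:
  "\<lbrakk>z \<in> carrier B; a \<in> carrier B; b \<in> carrier B\<rbrakk> \<Longrightarrow> dot_defect z a b = dot_defect z b a"
  by (simp add: dot_defect_def a_comm)

end

locale brace_dot_assoc = brace +
  fixes z
  assumes z_closed [simp]: "z \<in> carrier B"
    and dot_assoc: "\<lbrakk>a \<in> carrier B; b \<in> carrier B\<rbrakk> \<Longrightarrow> (a \<cdot> b) \<cdot> z = a \<cdot> (b \<cdot> z)"
begin

lemma dot_defect_scale_right:
  assumes "a \<in> carrier B" "g \<in> carrier B" "c \<in> carrier B"
  shows "dot_defect z a (g \<cdot> c) = g \<cdot> dot_defect z a c"
proof -
  \<comment> \<open>This choice makes \<open>a \<oplus> c = a \<otimes> x\<close>, so that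
    \<open>circ_dot\<close> evaluates \<open>(a \<oplus> c) \<cdot> z\<close>.\<close>
  obtain x where x: "x \<in> carrier B" "c = x \<oplus> a \<cdot> x"
    using dot_shift_surj assms(1,3) by blast
  define h where "h = inv a \<otimes> (g \<otimes> a)"
  have h: "h \<in> carrier B" using assms by (simp add: h_def)
  have shift: "(a \<oplus> (y \<oplus> a \<cdot> y)) \<cdot> z = a \<cdot> z \<oplus> (y \<cdot> z \<oplus> a \<cdot> (y \<cdot> z))"
    if "y \<in> carrier B" for y
    using circ_dot[of a y z] circ_eq_dot[of a y] that assms by (simp add: a_assoc)
  define w where "w = x \<cdot> z \<oplus> a \<cdot> (x \<cdot> z)"
  have w: "w \<in> carrier B" using x assms by (simp add: w_def)
  have c: "(a \<oplus> c) \<cdot> z = a \<cdot> z \<oplus> w"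
    using shift[of x] x by (simp add: w_def)
  \<comment> \<open>By \<open>dot_conj\<close>, \<open>g \<cdot> c\<close> is the image of
    \<open>h \<cdot> x\<close> under L_a, so \<open>shift\<close> applies to it as well.\<close>
  have "(a \<oplus> g \<cdot> c) \<cdot> z = a \<cdot> z \<oplus> (h \<cdot> (x \<cdot> z) \<oplus> a \<cdot> (h \<cdot> (x \<cdot> z)))"
    using shift[of "h \<cdot> x"] dot_conj[of a g x] assms x h
    by (simp add: h_def[symmetric] dot_assoc)
  also have "\<dots> = a \<cdot> z \<oplus> g \<cdot> w"
    using dot_conj[of a g "x \<cdot> z"] assms x by (simp add: h_def w_def)
  finally have gc: "(a \<oplus> g \<cdot> c) \<cdot> z = a \<cdot> z \<oplus> g \<cdot> w" .
  have cl: "a \<cdot> z \<in> carrier B" "c \<cdot> z \<in> carrier B" "g \<cdot> w \<in> carrier B"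
    "g \<cdot> (c \<cdot> z) \<in> carrier B"
    using assms w by simp_all
  have "dot_defect z a (g \<cdot> c) = g \<cdot> w \<ominus> g \<cdot> (c \<cdot> z)"
    unfolding dot_defect_def gc dot_assoc[OF assms(2,3)] using cl by algebra
  also have "\<dots> = g \<cdot> (w \<ominus> c \<cdot> z)"
    using cl w assms by (simp add: minus_eq dot_add dot_minus)
  also have "w \<ominus> c \<cdot> z = dot_defect z a c"
    unfolding dot_defect_def c using cl w by algebra
  finally show ?thesis .
qed

lemma dot_defect_scale_both:
  assumes "a \<in> carrier B" "g \<in> carrier B" "c \<in> carrier B"
  shows "dot_defect z (g \<cdot> a) (g \<cdot> c) = g \<cdot> dot_defect z a c"
  using assms
  by (simp add: dot_defect_def dot_add[symmetric] dot_assoc minus_eq dot_minus[symmetric])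

text \<open>The defect of \<open>g \<cdot> a\<close> and \<open>g \<cdot> c\<close> is computed
  twice: pulling \<open>g\<close> out of both arguments at once, or out of each in turn by
  symmetry.\<close>

lemma dot_dot_defect_idem:
  assumes "a \<in> carrier B" "g \<in> carrier B" "c \<in> carrier B"
  shows "g \<cdot> (g \<cdot> dot_defect z a c) = g \<cdot> dot_defect z a c"
  using assms dot_defect_scale_both[of a g c] dot_defect_scale_right[of "g \<cdot> a" g c]
    dot_defect_scale_right[of c g a]
  by (simp add: dot_defect_comm[of z "g \<cdot> a" c] dot_defect_comm[of z c a])

text \<open>By \<open>circ_dot\<close> and associativity, \<open>\<cdot> z\<close> is additive on
  the three-term sum \<open>a \<oplus> b \<oplus> a \<cdot> b\<close>, so the defects of its two
  additions cancel.\<close>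

lemma dot_defect_eq_minus:
  assumes "a \<in> carrier B" "b \<in> carrier B"
  shows "dot_defect z a b = \<ominus> dot_defect z (a \<oplus> b) (a \<cdot> b)"
proof -
  have eq: "(a \<oplus> b \<oplus> a \<cdot> b) \<cdot> z = a \<cdot> z \<oplus> b \<cdot> z \<oplus> a \<cdot> (b \<cdot> z)"
    using circ_dot[of a b z] circ_eq_dot[of a b] assms by simp
  have "a \<cdot> z \<in> carrier B" "b \<cdot> z \<in> carrier B" "a \<cdot> (b \<cdot> z) \<in> carrier B"
    "(a \<oplus> b) \<cdot> z \<in> carrier B"
    using assms by simp_all
  then show ?thesis
    unfolding dot_defect_def eq dot_assoc[OF assms] by algebra
qed

text \<open>The defect has the form \<open>a \<cdot> y\<close>, up to sign, with \<open>y\<close> a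
  defect; on such elements \<open>a\<close> acts as the identity.\<close>

lemma dot_dot_defect_left:
  assumes "a \<in> carrier B" "b \<in> carrier B"
  shows "a \<cdot> dot_defect z a b = dot_defect z a b"
proof -
  have "dot_defect z a b = \<ominus> (a \<cdot> dot_defect z (a \<oplus> b) b)"
    using dot_defect_eq_minus dot_defect_scale_right assms by simp
  then show ?thesis
    using dot_dot_defect_idem[of "a \<oplus> b" a b] assms by (simp add: dot_minus)
qed

lemma dot_dot_defect_right:
  assumes "a \<in> carrier B" "b \<in> carrier B"
  shows "b \<cdot> dot_defect z a b = dot_defect z a b"
  using dot_dot_defect_left[of b a] assms by (simp add: dot_defect_comm)

text \<open>Applying \<open>dot_defect_eq_minus\<close> twice cancels the signs and turns the first
  argument into \<open>a \<otimes> b\<close>.\<close>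

lemma circ_dot_dot_defect:
  assumes "a \<in> carrier B" "b \<in> carrier B"
  shows "(a \<otimes> b) \<cdot> dot_defect z a b = dot_defect z a b"
proof -
  let ?p = "a \<oplus> b" and ?u = "a \<cdot> b"
  have "dot_defect z a b = dot_defect z (?p \<oplus> ?u) (?p \<cdot> ?u)"
    using dot_defect_eq_minus[of a b] dot_defect_eq_minus[of ?p ?u] assms by simp
  then show ?thesis
    using dot_dot_defect_left[of "?p \<oplus> ?u" "?p \<cdot> ?u"] assms by (simp add: circ_eq_dot)
qed

lemma dot_defect_eq_zero:
  assumes "a \<in> carrier B" "b \<in> carrier B"
  shows "dot_defect z a b = \<zero>"
proof -
  define d where "d = dot_defect z a b"
  have d: "d \<in> carrier B" using assms by (simp add: d_def)
  have ad: "a \<cdot> d = d" and bd: "b \<cdot> d = d" and abd: "(a \<otimes> b) \<cdot> d = d"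
    using dot_dot_defect_left dot_dot_defect_right circ_dot_dot_defect assms
    by (simp_all add: d_def)
  have "d \<oplus> (d \<oplus> d) = d"
    using circ_dot[OF assms d] d by (simp add: ad bd abd a_assoc)
  then have dd: "d \<oplus> d = \<zero>"
    using d by simp
  \<comment> \<open>Rewriting \<open>d\<close> as \<open>a \<cdot> d\<close> yields the expansion of
    \<open>(inv a \<otimes> a) \<cdot> d\<close>, which vanishes by \<open>one_dot\<close>.\<close>
  have "d \<oplus> inv a \<cdot> (d \<oplus> d) = inv a \<cdot> d \<oplus> a \<cdot> d \<oplus> inv a \<cdot> (a \<cdot> d)"
    using assms d by (simp add: ad dot_add a_ac)
  also have "\<dots> = \<zero>"
    using circ_dot[of "inv a" a d] assms d by simp
  finally have "d = \<zero>"
    using assms d by (simp add: dd)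
  then show ?thesis
    by (simp add: d_def)
qed

end

theorem theorem3p5:
  fixes B (structure)
  assumes "brace B"
  shows "right_distributor B =
    {z \<in> carrier B. \<forall>a\<in>carrier B. \<forall>b\<in>carrier B. (a \<cdot> b) \<cdot> z = a \<cdot> (b \<cdot> z)}"
proof -
  interpret brace B by fact
  have "(\<forall>a\<in>carrier B. \<forall>b\<in>carrier B. (a \<oplus> b) \<cdot> z = a \<cdot> z \<oplus> b \<cdot> z) \<longleftrightarrow>
    (\<forall>a\<in>carrier B. \<forall>b\<in>carrier B. (a \<cdot> b) \<cdot> z = a \<cdot> (b \<cdot> z))" (is "?add \<longleftrightarrow> ?assoc")
    if z: "z \<in> carrier B" for z
  proof
    assume add: ?add
    show ?assoc
    proof (intro ballI)
      fix a b assume ab: "a \<in> carrier B" "b \<in> carrier B"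
      \<comment> \<open>Additivity is applied twice, to the sum
        \<open>a \<oplus> b \<oplus> a \<cdot> b\<close>.\<close>
      have "(a \<cdot> z \<oplus> b \<cdot> z) \<oplus> (a \<cdot> b) \<cdot> z = (a \<otimes> b) \<cdot> z"
        using add ab by (simp add: circ_eq_dot)
      also have "\<dots> = (a \<cdot> z \<oplus> b \<cdot> z) \<oplus> a \<cdot> (b \<cdot> z)"
        using ab z by (rule circ_dot)
      finally show "(a \<cdot> b) \<cdot> z = a \<cdot> (b \<cdot> z)"
        using ab z by simp
    qed
  next
    assume ?assoc
    then interpret brace_dot_assoc B z
      by unfold_locales (use z in auto)
    show ?add
    proof (intro ballI)
      fix a b assume ab: "a \<in> carrier B" "b \<in> carrier B"
      then have "(a \<oplus> b) \<cdot> z \<in> carrier B" "a \<cdot> z \<in> carrier B" "b \<cdot> z \<in> carrier B"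
        by simp_all
      then have "(a \<oplus> b) \<cdot> z = dot_defect z a b \<oplus> (a \<cdot> z \<oplus> b \<cdot> z)"
        unfolding dot_defect_def by algebra
      then show "(a \<oplus> b) \<cdot> z = a \<cdot> z \<oplus> b \<cdot> z"
        using ab by (simp add: dot_defect_eq_zero)
    qed
  qed
  then show ?thesis
    by (auto simp: right_distributor_iff_dot_add)
qed

end
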